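(* Let $\mathcal{A}\in\mathbb{R}^{n_1\times\cdots\times n_d}$ be an order-$d$ real tensor and let $\mathcal{C}=\mathbf{sym}(\mathcal{A})$. Then $\mathcal{C}$ is symmetric.
   Context: An order-$d$ tensor $\mathcal{A}\in\mathbb{R}^{n_1\times\cdots\times n_d}$ is a real $d$-dimensional array with entries $\mathcal{A}(i_1,\ldots,i_d)$, $1\le i_k\le n_k$. Transposition: for a permutation $\mathbf{p}=[p_1,\ldots,p_d]$ of $1,\ldots,d$, $\mathcal{A}^{<\mathbf{p}>}\in\mathbb{R}^{n_{p_1}\times\cdots\times n_{p_d}}$ is defined by $\mathcal{A}^{<\mathbf{p}>}(j_{p_1},\ldots,j_{p_d})=\mathcal{A}(j_1,\ldots,j_d)$ for $1\le j_k\le n_k$. An order-$d$ tensor $\mathcal{C}\in\mathbb{R}^{N\times\cdots\times N}$ is symmetric if $\mathcal{C}=\mathcal{C}^{<\mathbf{p}>}$ for every permutation $\mathbf{p}$ of $1,\ldots,d$. Symmetric embedding: let $N=n_1+\cdots+n_d$ and partition the index range $1,\ldots,N$ into consecutive ranges $\mathbf{r}_1,\ldots,\mathbf{r}_d$ with $\mathbf{r}_k = (1+n_1+\cdots+n_{k-1}),\ldots,(n_1+\cdots+n_k)$. Then $\mathcal{C}=\mathbf{sym}(\mathcal{A})$ is the order-$d$ tensor in $\mathbb{R}^{N\times\cdots\times N}$ whose blocks $\mathcal{C}_{\mathbf{i}}=\mathcal{C}(\mathbf{r}_{i_1},\ldots,\mathbf{r}_{i_d})$, $1\le i_k\le d$,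 are $\mathcal{C}_{\mathbf{i}}=\mathcal{A}^{<\mathbf{i}>}$ if $\mathbf{i}=[i_1,\ldots,i_d]$ is a permutation of $1,\ldots,d$, and $\mathcal{C}_{\mathbf{i}}=0\in\mathbb{R}^{n_{i_1}\times\cdots\times n_{i_d}}$ otherwise. *)

theory Defs
  imports Complex_Main "HOL-Library.FuncSet" "HOL-Combinatorics.Multiset_Permutations"
begin

text \<open>
  All numbering is 0-based: a tensor with dimension list \<open>[n\<^sub>0, \<dots>, n\<^sub>d\<^sub>-\<^sub>1]\<close> has the index tuples
  \<open>[j\<^sub>0, \<dots>, j\<^sub>d\<^sub>-\<^sub>1]\<close> with \<open>j\<^sub>k < n\<^sub>k\<close>. The tuple \<open>(x\<^bsub>p 0\<^esub>, x\<^bsub>p 1\<^esub>, \<dots>)\<close> is written \<open>map ((!) x) p\<close>.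
\<close>

definition indices :: "nat list \<Rightarrow> nat list set" where
  "indices ns = {js. length js = length ns \<and> (\<forall>k<length ns. js ! k < ns ! k)}"

text \<open>
  Entries outside the index range are fixed to be \<open>undefined\<close>, so that equality of tensors means
  equality of the dimensions and of all entries.
\<close>

typedef tensor = "{(ns :: nat list, f :: nat list \<Rightarrow> real). f \<in> extensional (indices ns)}"
  by (rule exI[of _ "([], \<lambda>_. undefined)"]) (auto simp: extensional_def)

definition dims :: "tensor \<Rightarrow> nat list" where
  "dims A = fst (Rep_tensor A)"

definition entry :: "tensor \<Rightarrow> nat list \<Rightarrow> real" where
  "entry A = snd (Rep_tensor A)"

abbreviation order :: "tensor \<Rightarrow> nat" where
  "order A \<equiv> length (dims A)"

definition mk_tensor :: "nat list \<Rightarrow> (nat list \<Rightarrow> real) \<Rightarrow> tensor" where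
  "mk_tensor ns f = Abs_tensor (ns, restrict f (indices ns))"

definition zero_tensor :: "nat list \<Rightarrow> tensor" where
  "zero_tensor ns = mk_tensor ns (\<lambda>_. 0)"

text \<open>
  The entry of the transposed tensor at \<open>ls\<close> is the entry of \<open>A\<close> at the tuple \<open>js\<close> with
  \<open>ls = (js\<^bsub>p 0\<^esub>, js\<^bsub>p 1\<^esub>, \<dots>)\<close>. Meaningful only if \<open>p\<close> is a permutation of the modes of \<open>A\<close>;
  see \<open>entry_transpose_tensor\<close> below.
\<close>

definition transpose_tensor :: "nat list \<Rightarrow> tensor \<Rightarrow> tensor" where
  "transpose_tensor p A = mk_tensor (map ((!) (dims A)) p)
     (\<lambda>ls. entry A (THE js. length js = order A \<and> map ((!) js) p = ls))"

definition symmetric_tensor :: "tensor \<Rightarrow> bool" where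
  "symmetric_tensor C \<longleftrightarrow> (\<exists>N. dims C = replicate (order C) N) \<and>
     (\<forall>p \<in> permutations_of_set {..<order C}. C = transpose_tensor p C)"

definition offset :: "nat list \<Rightarrow> nat \<Rightarrow> nat" where
  "offset ns k = sum_list (take k ns)"

definition block_range :: "nat list \<Rightarrow> nat \<Rightarrow> nat set" where
  "block_range ns k = {offset ns k ..< offset ns k + ns ! k}"

definition block_of :: "nat list \<Rightarrow> nat \<Rightarrow> nat" where
  "block_of ns j = (THE k. k < length ns \<and> j \<in> block_range ns k)"

text \<open>
  The subtensor \<open>C(r\<^bsub>i 0\<^esub>, r\<^bsub>i 1\<^esub>, \<dots>)\<close>, where \<open>r\<^sub>k\<close> is \<open>block_range ns k\<close>.
\<close>

definition block_tensor :: "nat list \<Rightarrow> nat list \<Rightarrow> tensor \<Rightarrow> tensor" where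
  "block_tensor ns is C = mk_tensor (map ((!) ns) is)
     (\<lambda>ls. entry C (map2 (\<lambda>i l. offset ns i + l) is ls))"

text \<open>
  The symmetric embedding, given entrywise: \<open>is\<close> is the block containing position \<open>js\<close>, and
  \<open>ls\<close> is that position relative to the block. The lemma \<open>block_sym_tensor\<close> below states the
  defining description of \<open>sym(A)\<close> by its blocks.
\<close>

definition sym_tensor :: "tensor \<Rightarrow> tensor" where
  "sym_tensor A = (let ns = dims A in
     mk_tensor (replicate (order A) (sum_list ns))
       (\<lambda>js. let is = map (block_of ns) js;
                 ls = map (\<lambda>j. j - offset ns (block_of ns j)) js
             in if is \<in> permutations_of_set {..<order A}
                then entry (transpose_tensor is A) ls else 0))"

lemma Rep_mk_tensor: "Rep_tensor (mk_tensor ns f) = (ns, restrict f (indices ns))"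
  unfolding mk_tensor_def by (rule Abs_tensor_inverse) auto

lemma dims_mk_tensor [simp]: "dims (mk_tensor ns f) = ns"
  by (simp add: dims_def Rep_mk_tensor)

lemma entry_mk_tensor [simp]: "js \<in> indices ns \<Longrightarrow> entry (mk_tensor ns f) js = f js"
  by (simp add: entry_def Rep_mk_tensor)

lemma tensor_eqI:
  assumes "dims A = dims B" and "\<And>js. js \<in> indices (dims A) \<Longrightarrow> entry A js = entry B js"
  shows "A = B"
proof -
  have ext: "entry T \<in> extensional (indices (dims T))" for T
    using Rep_tensor[of T] by (auto simp: entry_def dims_def split: prod.splits)
  have "entry A = entry B"
    by (rule extensionalityI[of _ "indices (dims A)"]) (use ext[of A] ext[of B] assms in auto)
  then show ?thesis
    using assms(1) by (metis Rep_tensor_inject dims_def entry_def prod_eq_iff)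
qed

lemma dims_transpose_tensor [simp]: "dims (transpose_tensor p A) = map ((!) (dims A)) p"
  by (simp add: transpose_tensor_def)

lemma dims_sym_tensor [simp]: "dims (sym_tensor A) = replicate (order A) (sum_list (dims A))"
  by (simp add: sym_tensor_def Let_def)

lemma entry_transpose_tensor:
  assumes p: "p \<in> permutations_of_set {..<order A}" and js: "js \<in> indices (dims A)"
  shows "entry (transpose_tensor p A) (map ((!) js) p) = entry A js"
proof -
  have sp: "set p = {..<order A}"
    using p by (simp add: permutations_of_set_def)
  have "map ((!) js) p \<in> indices (map ((!) (dims A)) p)"
    using js sp by (auto simp: indices_def)
  moreover have "(THE is. length is = order A \<and> map ((!) is) p = map ((!) js) p) = js"
    using js sp by (intro the_equality) (auto simp: indices_def intro!: nth_equalityI)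
  ultimately show ?thesis
    by (simp add: transpose_tensor_def)
qed

lemma offset_Suc: "k < length ns \<Longrightarrow> offset ns (Suc k) = offset ns k + ns ! k"
  by (simp add: offset_def take_Suc_conv_app_nth)

lemma offset_mono: "k \<le> m \<Longrightarrow> offset ns k \<le> offset ns m"
  unfolding offset_def by (metis le_add1 le_add_diff_inverse sum_list_append take_add)

lemma block_of_eq:
  assumes "k < length ns" "j \<in> block_range ns k"
  shows "block_of ns j = k"
  unfolding block_of_def
proof (rule the_equality)
  fix m assume m: "m < length ns \<and> j \<in> block_range ns m"
  have False if "k < m"
    using that assms m offset_mono[of "Suc k" m ns] by (auto simp: block_range_def offset_Suc)
  moreover have False if "m < k"
    using that assms m offset_mono[of "Suc m" k ns] by (auto simp: block_range_def offset_Suc)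
  ultimately show "m = k" by (meson linorder_neqE_nat)
qed (use assms in auto)

lemma block_sym_tensor:
  assumes "length is = order A" and "set is \<subseteq> {..<order A}"
  shows "block_tensor (dims A) is (sym_tensor A) =
    (if is \<in> permutations_of_set {..<order A} then transpose_tensor is A
     else zero_tensor (map ((!) (dims A)) is))"
proof (rule tensor_eqI)
  fix ls assume "ls \<in> indices (dims (block_tensor (dims A) is (sym_tensor A)))"
  then have ls: "ls \<in> indices (map ((!) (dims A)) is)"
    by (simp add: block_tensor_def)
  define ns where "ns = dims A"
  define js where "js = map2 (\<lambda>i l. offset ns i + l) is ls"
  have len: "length ls = length is" and lt: "\<And>k. k < length is \<Longrightarrow> ls ! k < ns ! (is ! k)"
    using ls by (auto simp: indices_def ns_def)
  have i: "is ! k < length ns" if "k < length is" for k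
    using assms(2) that by (metis lessThan_iff nth_mem ns_def subsetD)
  have b: "block_of ns (js ! k) = is ! k" if "k < length is" for k
    using that i lt len by (intro block_of_eq) (auto simp: js_def block_range_def)
  have "js ! k < sum_list ns" if "k < length is" for k
  proof -
    have "js ! k < offset ns (Suc (is ! k))"
      using that lt len i by (simp add: js_def offset_Suc)
    also have "\<dots> \<le> offset ns (length ns)"
      using i[OF that] by (intro offset_mono) simp
    finally show ?thesis by (simp add: offset_def)
  qed
  then have ind: "js \<in> indices (replicate (order A) (sum_list ns))"
    using len assms(1) by (auto simp: indices_def js_def)
  have is_eq: "map (block_of ns) js = is"
    using b len by (intro nth_equalityI) (auto simp: js_def)
  have ls_eq: "map (\<lambda>j. j - offset ns (block_of ns j)) js = ls"
  proof (rule nth_equalityI)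
    fix k assume "k < length (map (\<lambda>j. j - offset ns (block_of ns j)) js)"
    then have "k < length is" and "k < length js" using len by (auto simp: js_def)
    then show "map (\<lambda>j. j - offset ns (block_of ns j)) js ! k = ls ! k"
      using b[of k] len by (simp add: js_def)
  qed (use len in \<open>simp add: js_def\<close>)
  have "entry (sym_tensor A) js =
      (if is \<in> permutations_of_set {..<order A} then entry (transpose_tensor is A) ls else 0)"
    using ind by (simp add: sym_tensor_def Let_def is_eq ls_eq flip: ns_def)
  then show "entry (block_tensor (dims A) is (sym_tensor A)) ls =
      entry (if is \<in> permutations_of_set {..<order A} then transpose_tensor is A
        else zero_tensor (map ((!) (dims A)) is)) ls"
    using ls by (simp add: block_tensor_def zero_tensor_def js_def ns_def)
qed (simp add: block_tensor_def zero_tensor_def)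

end

theory Submission
  imports Defs
begin

text \<open>
  Permuting a position of \<open>sym(A)\<close> permutes its block index and its relative position in the same
  way. Whether the block index is a permutation of the modes is thereby unaffected, and if it is
  one, both the original and the permuted entry are the same entry of \<open>A\<close>.
\<close>

text \<open>As a multiset \<open>p\<close> is \<open>[0..<length xs]\<close>, and reading
  \<open>xs\<close> along that list gives back \<open>xs\<close>.\<close>

lemma mset_map_nth_permutation:
  assumes "p \<in> permutations_of_set {..<length xs}"
  shows "mset (map ((!) xs) p) = mset xs"
proof -
  have "distinct p" "set p = set [0..<length xs]"
    using permutations_of_setD[OF assms] by (simp_all only: set_upt lessThan_atLeast0)
  then have "mset p = mset [0..<length xs]"
    by (metis distinct_upt set_eq_iff_mset_eq_distinct)
  then have "image_mset ((!) xs) (mset p) = image_mset ((!) xs) (mset [0..<length xs])"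
    by (rule arg_cong)
  then show ?thesis
    unfolding mset_map[symmetric] map_nth .
qed

text \<open>Membership in \<open>permutations_of_set S\<close> depends only on the set of entries
  and on distinctness, and both are determined by the multiset.\<close>

lemma map_nth_permutation_in_permutations_of_set_iff:
  assumes "p \<in> permutations_of_set {..<length xs}"
  shows "map ((!) xs) p \<in> permutations_of_set S \<longleftrightarrow> xs \<in> permutations_of_set S"
  using mset_eq_setD[OF mset_map_nth_permutation[OF assms]]
    mset_eq_imp_distinct_iff[OF mset_map_nth_permutation[OF assms]]
  by (simp only: permutations_of_set_def mem_Collect_eq)

lemma ex_map_nth_permutation:
  assumes p: "p \<in> permutations_of_set {..<n}" and xs: "length xs = n"
  obtains ys where "length ys = n" "map ((!) ys) p = xs"
proof
  have len: "length p = n" and dist: "distinct p" and set: "set p = {..<n}"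
    using permutations_of_setD[OF p] length_finite_permutations_of_set[OF p] by simp_all
  \<comment> \<open>The \<open>THE\<close> term is the inverse permutation of \<open>p\<close> at
    \<open>m\<close>, so \<open>ys\<close> is \<open>xs\<close> reindexed by that inverse.\<close>
  define ys where "ys = map (\<lambda>m. xs ! (THE k. k < n \<and> p ! k = m)) [0..<n]"
  show "length ys = n" by (simp add: ys_def)
  show "map ((!) ys) p = xs"
  proof (rule nth_equalityI)
    fix k assume "k < length (map ((!) ys) p)"
    then have k: "k < n" by (simp add: len)
    have "(THE i. i < n \<and> p ! i = p ! k) = k"
      using k dist len by (auto simp: nth_eq_iff_index_eq)
    moreover have "p ! k < n" using k len set nth_mem by blast
    ultimately show "map ((!) ys) p ! k = xs ! k"
      using k by (simp add: ys_def len)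
  qed (simp add: len xs)
qed

text \<open>Since \<open>p ! k\<close> runs through all modes, both sides impose the same bounds,
  only in another order.\<close>

lemma map_nth_permutation_in_indices_iff:
  assumes "p \<in> permutations_of_set {..<length ns}" "length js = length ns"
  shows "map ((!) js) p \<in> indices (map ((!) ns) p) \<longleftrightarrow> js \<in> indices ns"
proof -
  have "set p = {..<length ns}"
    using permutations_of_setD(1)[OF assms(1)] .
  then have "(\<forall>k<length p. js ! (p ! k) < ns ! (p ! k)) \<longleftrightarrow> (\<forall>m<length ns. js ! m < ns ! m)"
    by (metis in_set_conv_nth lessThan_iff)
  then show ?thesis
    using assms(2) by (simp add: indices_def)
qed

text \<open>Reindexing by \<open>p\<close> is onto, so it suffices to compare entries at tuples
  \<open>map ((!) js) p\<close>, where \<open>entry_transpose_tensor\<close> evaluates the transpose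
  without its \<open>THE\<close>.\<close>

lemma transpose_tensor_eqI:
  assumes p: "p \<in> permutations_of_set {..<order C}"
    and d: "map ((!) (dims C)) p = dims C"
    and e: "\<And>js. js \<in> indices (dims C) \<Longrightarrow> entry C (map ((!) js) p) = entry C js"
  shows "transpose_tensor p C = C"
proof (rule tensor_eqI)
  fix ls assume "ls \<in> indices (dims (transpose_tensor p C))"
  then have ls: "ls \<in> indices (map ((!) (dims C)) p)" by simp
  then have "length ls = order C"
    by (simp add: d indices_def)
  then obtain js where js: "length js = order C" "map ((!) js) p = ls"
    using ex_map_nth_permutation[OF p] by blast
  then have "js \<in> indices (dims C)"
    using ls map_nth_permutation_in_indices_iff[OF p] by blast
  then show "entry (transpose_tensor p C) ls = entry C ls"
    using entry_transpose_tensor[OF p] e js(2) by metis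
qed (simp add: d)

lemma ex_block_range:
  assumes "j < sum_list ns"
  shows "\<exists>k<length ns. j \<in> block_range ns k"
proof -
  have "j < offset ns (length ns)" using assms by (simp add: offset_def)
  moreover have "\<not> j < offset ns 0" by (simp add: offset_def)
  \<comment> \<open>The offsets start at 0 and end above \<open>j\<close>, so \<open>j\<close> lies
    between two consecutive ones.\<close>
  ultimately obtain k where "k < length ns" "\<not> j < offset ns k" "j < offset ns (Suc k)"
    using ex_least_nat_less[of "\<lambda>k. j < offset ns k" "length ns"] by blast
  then show ?thesis by (auto simp: block_range_def offset_Suc)
qed

text \<open>Existence of a block makes the \<open>THE\<close> in \<open>block_of\<close> meaningful.
  The bound makes relative positions valid indices of a transposed \<open>A\<close>.\<close>

lemma diff_offset_block_of_less:
  assumes "j < sum_list ns"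
  shows "j - offset ns (block_of ns j) < ns ! block_of ns j"
  using ex_block_range[OF assms] block_of_eq by (auto simp: block_range_def)

lemma entry_sym_tensor:
  assumes "js \<in> indices (replicate (order A) (sum_list (dims A)))"
  shows "entry (sym_tensor A) js =
    (if map (block_of (dims A)) js \<in> permutations_of_set {..<order A}
     then entry (transpose_tensor (map (block_of (dims A)) js) A)
       (map (\<lambda>j. j - offset (dims A) (block_of (dims A) j)) js)
     else 0)"
  using assms by (simp add: sym_tensor_def Let_def)

lemma entry_sym_tensor_permute:
  assumes p: "p \<in> permutations_of_set {..<order A}"
    and js: "js \<in> indices (replicate (order A) (sum_list (dims A)))"
  shows "entry (sym_tensor A) (map ((!) js) p) = entry (sym_tensor A) js"
proof -
  define b where "b = block_of (dims A)"
  define r where "r = (\<lambda>j. j - offset (dims A) (b j))"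
  have len: "length js = order A" and lt: "\<And>j. j \<in> set js \<Longrightarrow> j < sum_list (dims A)"
    using js by (auto simp: indices_def in_set_conv_nth)
  have set: "set p = {..<order A}" and lenp: "length p = order A"
    using permutations_of_setD[OF p] length_finite_permutations_of_set[OF p] by simp_all
  have js': "map ((!) js) p \<in> indices (replicate (order A) (sum_list (dims A)))"
    using lt len set lenp by (auto simp: indices_def) (metis lessThan_iff nth_mem)
  \<comment> \<open>With \<open>f\<close> taken as \<open>b\<close> and as \<open>r\<close>, this is
    the common action of \<open>p\<close> on block indices and relative positions.\<close>
  have swap: "map f (map ((!) js) p) = map ((!) (map f js)) p" for f :: "nat \<Rightarrow> nat"
    using set len by auto
  have iff: "map ((!) (map b js)) p \<in> permutations_of_set {..<order A} \<longleftrightarrow>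
      map b js \<in> permutations_of_set {..<order A}"
    using p len by (intro map_nth_permutation_in_permutations_of_set_iff) simp
  have "entry (transpose_tensor (map ((!) (map b js)) p) A) (map ((!) (map r js)) p) =
      entry (transpose_tensor (map b js) A) (map r js)"
    if perm: "map b js \<in> permutations_of_set {..<order A}"
  proof -
    \<comment> \<open>\<open>xs\<close> is the index tuple of \<open>A\<close> whose entry
      \<open>sym_tensor A\<close> holds at \<open>js\<close>.\<close>
    obtain xs where xs: "length xs = order A" "map ((!) xs) (map b js) = map r js"
      using ex_map_nth_permutation[OF perm, of "map r js"] len by auto
    have "map r js \<in> indices (map ((!) (dims A)) (map b js))"
      using diff_offset_block_of_less lt by (simp add: indices_def r_def b_def)
    then have ind: "xs \<in> indices (dims A)"
      unfolding xs(2)[symmetric] map_nth_permutation_in_indices_iff[OF perm xs(1)] .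
    \<comment> \<open>The same \<open>xs\<close>, read along the permuted block index, gives the
      permuted relative position; hence both entries equal \<open>entry A xs\<close>.\<close>
    have "map ((!) (map r js)) p = map ((!) (map ((!) xs) (map b js))) p"
      by (simp only: xs(2))
    also have "\<dots> = map ((!) xs) (map ((!) (map b js)) p)"
      using set len by (simp add: nth_map)
    finally show ?thesis
      unfolding entry_transpose_tensor[OF perm ind, unfolded xs(2)]
      using entry_transpose_tensor[OF iff[THEN iffD2, OF perm] ind] by (simp only:)
  qed
  \<comment> \<open>By \<open>iff\<close> both case distinctions have the same condition;
    \<open>if_cong\<close> supplies it as the premise of the equation just proved, and otherwise
    both entries are 0.\<close>
  then show ?thesis
    unfolding entry_sym_tensor[OF js] entry_sym_tensor[OF js'] swap
      b_def[symmetric] r_def[symmetric]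
    by (simp only: iff cong: if_cong)
qed

theorem lemma2p2:
  fixes A C :: tensor
  assumes "C = sym_tensor A"
  shows "symmetric_tensor C"
  unfolding symmetric_tensor_def
proof (intro conjI ballI)
  have ord: "order C = order A" by (simp add: assms)
  show "\<exists>N. dims C = replicate (order C) N" by (simp add: assms)
  fix p assume "p \<in> permutations_of_set {..<order C}"
  then have p: "p \<in> permutations_of_set {..<order A}" by (simp add: ord)
  have lenp: "length p = order A" and set: "set p = {..<order A}"
    using permutations_of_setD[OF p] length_finite_permutations_of_set[OF p] by simp_all
  \<comment> \<open>All modes of \<open>C\<close> have the same dimension, so reordering them
    changes nothing.\<close>
  have "map ((!) (dims C)) p = dims C"
    using nth_mem[of _ p] by (intro nth_equalityI) (auto simp: assms lenp set)
  then show "C = transpose_tensor p C"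
    using p entry_sym_tensor_permute[OF p]
    by (intro transpose_tensor_eqI[symmetric]) (auto simp: assms)
qed

end
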